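(* Let $\mathcal K=\mathbb R^n_+$ and let $(\mu;\eta_0)$ be an $\mathbb R^n_+$-sublinear inequality for $\mathcal S(A,\mathbb R^n_+,\mathcal B)$. Let $a^i$ be the $i$-th column of the matrix $A$, $e^i$ the $i$-th unit vector of $\mathbb R^n$, $\perp_{e^i}=\{\gamma\in\mathbb R^n_+:\gamma_i=0\}$, and $D_\mu=\{\lambda\in\mathbb R^m: A^T\lambda\le\mu\}$ (componentwise inequality). Then for all $i=1,\dots,n$, $\perp_{e^i}\cap(\mu-\mathrm{Im}(A^T))\neq\emptyset$, and thus $\sigma_{D_\mu}(a^i)=\mu_i$. Moreover, $\inf_{b\in\mathcal B}\sigma_{D_\mu}(b)=\vartheta(\mu)$.
   Context: $A$ is a real $m\times n$ matrix; $\mathcal B\subseteq\mathbb R^m$ is an arbitrary nonempty set; $\mathcal S(A,\mathbb R^n_+,\mathcal B)=\{x\in\mathbb R^n_+:Ax\in\mathcal B\}$, assumed nonempty and different from $\mathbb R^n_+$. $\vartheta(\mu)=\inf\{\mu^Tx:x\in\mathcal S(A,\mathbb R^n_+,\mathcal B)\}$. The support function of a nonempty set $D\subseteq\mathbb R^m$ is $\sigma_D(z)=\sup\{z^T\lambda:\lambda\in D\}$. An inequality $(\mu;\eta_0)$ with $0\ne\mu\in\mathbb R^n$, $\eta_0\in\mathbb R$, is $\mathbb R^n_+$-sublinear if (A.1) for every $\alpha\in\mathrm{Ext}(\mathbb R^n_+)$: $0\le\mu^Tu$ for all $u\in\mathbb R^n$ such that $Au=0$ and $(\alpha^Tv)u+v\in\mathbb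 R^n_+$ for all $v\in\mathrm{Ext}(\mathbb R^n_+)$; and (A.2) $\eta_0\le\mu^Tx$ for all $x\in\mathcal S(A,\mathbb R^n_+,\mathcal B)$. Here $\mathrm{Ext}(\mathbb R^n_+)$ is the set of extreme rays of $\mathbb R^n_+$, i.e. positive multiples of the unit vectors. *)

theory Defs
  imports "HOL-Analysis.Analysis"
begin

definition nonneg_orthant :: "(real ^ 'n) set" where
  "nonneg_orthant = {x. \<forall>i. 0 \<le> x $ i}"

text \<open>Points \<open>x\<close> generating an extreme ray of the cone \<open>K\<close>, i.e. a half-line from the origin that
  is a face of \<open>K\<close>. For the nonnegative orthant these are the positive multiples of the unit
  vectors (\<open>Ext_nonneg_orthant\<close> below).\<close>
definition Ext :: "'a::real_vector set \<Rightarrow> 'a set" where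
  "Ext K = {x. x \<noteq> 0 \<and> cone hull {x} face_of K}"

lemma cone_hull_sing: "cone hull {x} = {c *\<^sub>R x | c. 0 \<le> c}" for x :: "'a::real_vector"
  by (auto simp: cone_hull_expl)

lemma Ext_nonneg_orthant:
  "Ext (nonneg_orthant :: (real ^ 'n) set) = {t *\<^sub>R axis i 1 | t i. 0 < t}"
proof (intro equalityI subsetI)
  fix x :: "real ^ 'n"
  assume "x \<in> Ext nonneg_orthant"
  then have x0: "x \<noteq> 0" and F: "cone hull {x} face_of nonneg_orthant"
    by (auto simp: Ext_def)
  have xc: "x \<in> cone hull {x}" by (simp add: hull_inc)
  then have nn: "0 \<le> x $ j" for j
    using face_of_imp_subset[OF F] by (auto simp: nonneg_orthant_def)
  obtain i where i: "x $ i \<noteq> 0" using x0 by (auto simp: vec_eq_iff)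
  with nn[of i] have pos: "0 < x $ i" by simp
  let ?e = "axis i 1 :: real ^ 'n"
  let ?a = "(2 * x $ i) *\<^sub>R ?e" and ?b = "2 *\<^sub>R (x - (x $ i) *\<^sub>R ?e)"
  have bi: "?b $ i = 0" by (simp add: axis_def)
  have ai: "?a $ i = 2 * x $ i" by (simp add: axis_def)
  have ne: "?a \<noteq> ?b" using ai bi pos by (metis mult_eq_0_iff less_irrefl zero_neq_numeral)
  have "x = (1 - 1/2) *\<^sub>R ?a + (1/2) *\<^sub>R ?b" by (simp add: vec_eq_iff)
  then have seg: "x \<in> open_segment ?a ?b"
    using ne unfolding in_segment by (intro conjI exI[of _ "1/2"]) auto
  have "?a \<in> nonneg_orthant" "?b \<in> nonneg_orthant"
    using nn by (auto simp: nonneg_orthant_def axis_def)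
  then have "?a \<in> cone hull {x}"
    using F seg xc unfolding face_of_def by blast
  then obtain c where c: "?a = c *\<^sub>R x" by (auto simp: cone_hull_sing)
  then have "2 * x $ i = c * x $ i" using ai by (metis vector_scaleR_component real_scaleR_def)
  with pos have "c = 2" by simp
  with c have "x = (x $ i) *\<^sub>R ?e" by (simp add: vec_eq_iff)
  with pos show "x \<in> {t *\<^sub>R axis i 1 | t i. 0 < t}" by blast
next
  fix x :: "real ^ 'n"
  assume "x \<in> {t *\<^sub>R axis i 1 | t i. 0 < t}"
  then obtain t i where t: "0 < t" and x: "x = t *\<^sub>R axis i 1" by blast
  have C: "y \<in> cone hull {x} \<longleftrightarrow> 0 \<le> y $ i \<and> (\<forall>j. j \<noteq> i \<longrightarrow> y $ j = 0)" for y
  proof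
    assume "y \<in> cone hull {x}"
    then show "0 \<le> y $ i \<and> (\<forall>j. j \<noteq> i \<longrightarrow> y $ j = 0)"
      using t by (auto simp: cone_hull_sing x axis_def)
  next
    assume "0 \<le> y $ i \<and> (\<forall>j. j \<noteq> i \<longrightarrow> y $ j = 0)"
    then have "y = (y $ i / t) *\<^sub>R x" "0 \<le> y $ i / t"
      using t by (auto simp: x vec_eq_iff axis_def)
    then show "y \<in> cone hull {x}" unfolding cone_hull_sing by blast
  qed
  have "cone hull {x} face_of nonneg_orthant"
    unfolding face_of_def
  proof (intro conjI ballI impI)
    show "cone hull {x} \<subseteq> nonneg_orthant"
    proof
      fix y assume "y \<in> cone hull {x}"
      then have "0 \<le> y $ j" for j using C[of y] by (cases "j = i") auto
      then show "y \<in> nonneg_orthant" by (simp add: nonneg_orthant_def)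
    qed
    show "convex (cone hull {x})" by (simp add: convex_cone_hull)
  next
    fix a b y
    assume a: "a \<in> nonneg_orthant" and b: "b \<in> nonneg_orthant" and y: "y \<in> cone hull {x}"
      and "y \<in> open_segment a b"
    then obtain u where u: "0 < u" "u < 1" "y = (1 - u) *\<^sub>R a + u *\<^sub>R b"
      by (auto simp: in_segment)
    have nn: "0 \<le> a $ j" "0 \<le> b $ j" for j using a b by (auto simp: nonneg_orthant_def)
    have z: "a $ j = 0 \<and> b $ j = 0" if "j \<noteq> i" for j
    proof -
      have "0 = (1 - u) * a $ j + u * b $ j" using y that C[of y] u by simp
      moreover have "0 \<le> (1 - u) * a $ j" "0 \<le> u * b $ j" using u nn by simp_all
      ultimately have "(1 - u) * a $ j = 0" "u * b $ j = 0" by linarith+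
      with u show ?thesis by simp
    qed
    show "a \<in> cone hull {x}" using C[of a] nn z by auto
    show "b \<in> cone hull {x}" using C[of b] nn z by auto
  qed
  moreover have "x \<noteq> 0" using t x by (auto simp: vec_eq_iff axis_def)
  ultimately show "x \<in> Ext nonneg_orthant" by (simp add: Ext_def)
qed

definition sol_set :: "real ^ 'n ^ 'm \<Rightarrow> (real ^ 'n) set \<Rightarrow> (real ^ 'm) set \<Rightarrow> (real ^ 'n) set" where
  "sol_set A K B = {x \<in> K. A *v x \<in> B}"

definition sublinear_ineq :: "real ^ 'n ^ 'm \<Rightarrow> (real ^ 'm) set \<Rightarrow> real ^ 'n \<Rightarrow> real \<Rightarrow> bool" where
  "sublinear_ineq A B \<mu> \<eta>0 \<longleftrightarrow>
     \<mu> \<noteq> 0 \<and>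
     (\<forall>\<alpha> \<in> Ext nonneg_orthant. \<forall>u.
        A *v u = 0 \<and> (\<forall>v \<in> Ext nonneg_orthant. (\<alpha> \<bullet> v) *\<^sub>R u + v \<in> nonneg_orthant) \<longrightarrow>
        0 \<le> \<mu> \<bullet> u) \<and>
     (\<forall>x \<in> sol_set A nonneg_orthant B. \<eta>0 \<le> \<mu> \<bullet> x)"

text \<open>The optimal value and the support function are extended-real valued, so that the
  infimum and supremum are the true ones without boundedness side conditions; the support
  function does take the value \<open>\<infinity>\<close>.\<close>

definition opt_val :: "real ^ 'n ^ 'm \<Rightarrow> (real ^ 'm) set \<Rightarrow> real ^ 'n \<Rightarrow> ereal" where
  "opt_val A B \<mu> = (INF x \<in> sol_set A nonneg_orthant B. ereal (\<mu> \<bullet> x))"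

definition support_fn :: "'a::real_inner set \<Rightarrow> 'a \<Rightarrow> ereal" where
  "support_fn D z = (SUP y \<in> D. ereal (z \<bullet> y))"

definition dual_set :: "real ^ 'n ^ 'm \<Rightarrow> real ^ 'n \<Rightarrow> (real ^ 'm) set" where
  "dual_set A \<mu> = {y. \<forall>i. (transpose A *v y) $ i \<le> \<mu> $ i}"

definition perp_axis :: "'n \<Rightarrow> (real ^ 'n) set" where
  "perp_axis i = {\<gamma> \<in> nonneg_orthant. \<gamma> $ i = 0}"

end

theory Submission
  imports Defs
begin

text \<open>
  Everything rests on Farkas' lemma: a finitely generated cone is closed, so a point outside it
  is separated from it by a hyperplane through the origin. The lemma is used for two cones.

  \<^item> The condition on extreme rays, tested on short multiples of the \<open>i\<close>-th unit vector, says that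
    \<open>\<mu>\<close> is nonnegative on the vectors of the kernel of \<open>A\<close> whose coordinates other than the \<open>i\<close>-th are
    nonnegative. These vectors form the dual cone of \<open>Im A\<^sup>T + \<bottom>\<^sub>i\<close>, where \<open>\<bottom>\<^sub>i\<close> is the face of the
    orthant orthogonal to the \<open>i\<close>-th unit vector. So Farkas' lemma writes \<open>\<mu>\<close> as \<open>A\<^sup>T y + \<gamma>\<close> with
    \<open>\<gamma> \<in> \<bottom>\<^sub>i\<close> (\<open>perp_axis_meets_translate\<close>). Such a \<open>y\<close> belongs to \<open>D\<^sub>\<mu>\<close> and makes the \<open>i\<close>-th
    constraint tight, hence attains the bound \<open>\<mu>\<^sub>i\<close> for the support function at the \<open>i\<close>-th column.

  \<^item> In particular \<open>D\<^sub>\<mu>\<close> is nonempty, which is what strong linear programming duality needs: the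
    support function of \<open>D\<^sub>\<mu>\<close> at any \<open>b\<close> is the optimal value of minimising \<open>\<mu> \<bullet> x\<close> over \<open>x \<ge> 0\<close> with
    \<open>A x = b\<close>, both being \<open>\<infinity>\<close> if there is no such \<open>x\<close> (\<open>support_fn_dual_set\<close>). Minimising over
    \<open>b \<in> B\<close> gives \<open>\<vartheta>(\<mu>)\<close>.
\<close>

lemma farkas_convex_cone_hull:
  fixes z :: "'a::euclidean_space"
  assumes "finite S" and pos: "\<And>a. (\<And>s. s \<in> S \<Longrightarrow> 0 \<le> a \<bullet> s) \<Longrightarrow> 0 \<le> a \<bullet> z"
  shows "z \<in> convex_cone hull S"
proof (rule ccontr)
  let ?C = "convex_cone hull S"
  assume "z \<notin> ?C"
  then obtain a b where az: "a \<bullet> z < b" and aC: "\<And>x. x \<in> ?C \<Longrightarrow> b < a \<bullet> x"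
    using separating_hyperplane_closed_point[OF convex_convex_cone_hull
        closed_convex_cone_hull[OF \<open>finite S\<close>]] by blast
  have "b < 0" using aC[OF convex_cone_hull_contains_0] by simp
  have "0 \<le> a \<bullet> s" if "s \<in> S" for s
  proof (rule ccontr)
    assume neg: "\<not> 0 \<le> a \<bullet> s"
    \<comment> \<open>At this point of the ray through \<open>s\<close> the functional \<open>a\<close> takes the value \<open>b\<close>.\<close>
    have "(b / (a \<bullet> s)) *\<^sub>R s \<in> ?C"
      using neg \<open>b < 0\<close> that by (intro convex_cone_hull_mul hull_inc) (auto simp: divide_nonpos_neg)
    from aC[OF this] neg show False by simp
  qed
  from pos[OF this] az \<open>b < 0\<close> show False by simp
qed

lemma inner_axis_one: "x \<bullet> axis i (1::real) = x $ i"
  by (simp add: inner_axis)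

lemma inner_transpose_mult: "(transpose A *v y) \<bullet> x = y \<bullet> (A *v x)"
  for A :: "real ^ 'n ^ 'm"
  by (simp add: dot_lmul_matrix flip: vector_transpose_matrix)

lemma transpose_mult_nth: "(transpose A *v y) $ i = column i A \<bullet> y"
  for A :: "real ^ 'n ^ 'm"
  by (simp add: matrix_vector_mult_def transpose_def column_def inner_vec_def)

lemma sublinear_ineq_nonneg_on_kernel:
  fixes A :: "real ^ 'n ^ 'm"
  assumes sub: "sublinear_ineq A B \<mu> \<eta>0"
    and Au: "A *v u = 0" and u: "\<And>j. j \<noteq> i \<Longrightarrow> 0 \<le> u $ j"
  shows "0 \<le> \<mu> \<bullet> u"
proof -
  \<comment> \<open>The length of the ray generator \<open>\<alpha>\<close> is free, and \<open>t\<close> is short enough for \<open>t u\<^sub>i + 1 \<ge> 0\<close>.\<close>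
  define t where "t = inverse (\<bar>u $ i\<bar> + 1)"
  have t: "0 < t" "0 \<le> t * u $ i + 1"
    unfolding t_def by (auto simp: field_simps)
  let ?\<alpha> = "t *\<^sub>R axis i 1 :: real ^ 'n"
  have "(?\<alpha> \<bullet> v) *\<^sub>R u + v \<in> nonneg_orthant" if v: "v \<in> Ext nonneg_orthant" for v
  proof -
    obtain s k where s: "0 < s" and veq: "v = s *\<^sub>R axis k 1"
      using v unfolding Ext_nonneg_orthant by blast
    have \<alpha>v: "?\<alpha> \<bullet> v = (if k = i then t * s else 0)" by (simp add: veq inner_axis_axis)
    have "0 \<le> ((?\<alpha> \<bullet> v) *\<^sub>R u + v) $ j" for j
    proof (cases "k = i")
      case False
      then show ?thesis using s unfolding \<alpha>v by (simp add: veq axis_def)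
    next
      case True
      have "0 \<le> s * (t * u $ i + 1)" using s t by simp
      then show ?thesis
        using True s t u[of j] unfolding \<alpha>v by (auto simp: veq axis_def algebra_simps)
    qed
    then show ?thesis by (simp add: nonneg_orthant_def)
  qed
  moreover have "?\<alpha> \<in> Ext nonneg_orthant" unfolding Ext_nonneg_orthant using t by blast
  ultimately show ?thesis using sub Au unfolding sublinear_ineq_def by blast
qed

text \<open>A vector has nonnegative inner products with plus and minus the rows of \<open>A\<close> and with the unit
  vectors other than the \<open>i\<close>-th just if it lies in the kernel of \<open>A\<close> and its coordinates other
  than the \<open>i\<close>-th are nonnegative; on such vectors \<open>\<mu>\<close> is nonnegative. The cone generated by these
  rows and unit vectors is \<open>Im A\<^sup>T + \<bottom>\<^sub>i\<close>.\<close>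
lemma perp_axis_meets_translate:
  fixes A :: "real ^ 'n ^ 'm"
  assumes sub: "sublinear_ineq A B \<mu> \<eta>0"
  obtains y where "\<mu> - transpose A *v y \<in> perp_axis i"
proof -
  define T where "T = {transpose A *v y + \<gamma> | y \<gamma>. \<gamma> \<in> perp_axis i}"
  define S :: "(real ^ 'n) set" where
    "S = range (\<lambda>k. row k A) \<union> range (\<lambda>k. - row k A) \<union> (\<lambda>j. axis j 1) ` (- {i})"
  have "\<mu> \<in> convex_cone hull S"
  proof (rule farkas_convex_cone_hull)
    show "finite S" by (simp add: S_def)
    fix u assume u: "\<And>s. s \<in> S \<Longrightarrow> 0 \<le> u \<bullet> s"
    have "(A *v u) $ k = 0" for k
      using u[of "row k A"] u[of "- row k A"]
      by (simp add: S_def matrix_vector_mul_component row_def inner_commute vec_lambda_eta)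
    then have "A *v u = 0" by (simp add: vec_eq_iff)
    moreover have "0 \<le> u $ j" if "j \<noteq> i" for j
      using u[of "axis j 1"] that by (simp add: S_def inner_axis_one)
    ultimately show "0 \<le> u \<bullet> \<mu>"
      unfolding inner_commute[of u] by (rule sublinear_ineq_nonneg_on_kernel[OF sub])
  qed
  also have "\<dots> \<subseteq> T"
  proof (rule hull_minimal)
    have row: "transpose A *v axis k 1 = row k A" for k
      by (simp add: matrix_vector_mult_basis column_transpose)
    have 0: "0 \<in> perp_axis i" by (simp add: perp_axis_def nonneg_orthant_def)
    have im: "transpose A *v y \<in> T" for y
      using 0 unfolding T_def by (metis (mono_tags, lifting) add.right_neutral mem_Collect_eq)
    have "row k A \<in> T" for k
      using im[of "axis k 1"] unfolding row .
    moreover have "- row k A \<in> T" for k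
      using im[of "(- 1) *\<^sub>R axis k 1"] unfolding matrix_vector_mult_scaleR row by simp
    moreover have "axis j 1 \<in> T" if "j \<noteq> i" for j
    proof -
      have "axis j 1 \<in> perp_axis i"
        using that by (auto simp: perp_axis_def nonneg_orthant_def axis_def)
      then show ?thesis unfolding T_def
        by (metis (mono_tags, lifting) add_0 matrix_vector_mult_0_right mem_Collect_eq)
    qed
    ultimately show "S \<subseteq> T" by (auto simp: S_def)
    show "convex_cone T"
      unfolding convex_cone_iff
    proof (intro conjI ballI allI impI)
      show "0 \<in> T" using im[of 0] by simp
    next
      fix a b assume "a \<in> T" "b \<in> T"
      then obtain y \<gamma> z \<delta> where "a = transpose A *v y + \<gamma>" "b = transpose A *v z + \<delta>"
        and p: "\<gamma> \<in> perp_axis i" "\<delta> \<in> perp_axis i"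
        unfolding T_def by blast
      then have "a + b = transpose A *v (y + z) + (\<gamma> + \<delta>)"
        by (simp add: matrix_vector_right_distrib)
      moreover have "\<gamma> + \<delta> \<in> perp_axis i" using p by (simp add: perp_axis_def nonneg_orthant_def)
      ultimately show "a + b \<in> T" unfolding T_def by blast
    next
      fix a and c :: real assume "a \<in> T" "0 \<le> c"
      then obtain y \<gamma> where "a = transpose A *v y + \<gamma>" and p: "\<gamma> \<in> perp_axis i"
        unfolding T_def by blast
      then have "c *\<^sub>R a = transpose A *v (c *\<^sub>R y) + c *\<^sub>R \<gamma>"
        by (simp add: matrix_vector_mult_scaleR scaleR_add_right)
      moreover have "c *\<^sub>R \<gamma> \<in> perp_axis i"
        using p \<open>0 \<le> c\<close> by (simp add: perp_axis_def nonneg_orthant_def)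
      ultimately show "c *\<^sub>R a \<in> T" unfolding T_def by blast
    qed
  qed
  finally obtain y \<gamma> where "\<mu> = transpose A *v y + \<gamma>" "\<gamma> \<in> perp_axis i"
    unfolding T_def by blast
  then show thesis by (intro that[of y]) simp
qed

lemma dual_set_iff: "y \<in> dual_set A \<mu> \<longleftrightarrow> (\<forall>j. column j A \<bullet> y \<le> \<mu> $ j)"
  by (simp add: dual_set_def transpose_mult_nth del: transpose_matrix_vector)

lemma dual_set_weak_duality:
  fixes A :: "real ^ 'n ^ 'm"
  assumes "y \<in> dual_set A \<mu>" and "x \<in> nonneg_orthant"
  shows "(A *v x) \<bullet> y \<le> \<mu> \<bullet> x"
proof -
  have "(A *v x) \<bullet> y = (transpose A *v y) \<bullet> x"
    by (simp only: inner_transpose_mult inner_commute[of _ y])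
  also have "\<dots> \<le> \<mu> \<bullet> x"
    using assms unfolding inner_vec_def dual_set_def nonneg_orthant_def
    by (auto intro!: sum_mono mult_right_mono)
  finally show ?thesis .
qed

text \<open>The pairs \<open>(A x, s)\<close> with \<open>x \<ge> 0\<close> and \<open>\<mu> \<bullet> x \<le> s\<close> form the cone generated by \<open>(0, 1)\<close> and the
  \<open>(a\<^sub>j, \<mu>\<^sub>j)\<close>, where the \<open>a\<^sub>j\<close> are the columns of \<open>A\<close>. By Farkas' lemma it contains \<open>(b, r)\<close> if every
  functional \<open>(p, q)\<close> that is nonnegative on the generators is nonnegative at \<open>(b, r)\<close>. Such a
  functional has \<open>q \<ge> 0\<close>. If \<open>q > 0\<close>, then \<open>-p / q\<close> is a dual point and the bound \<open>r\<close> applies to it.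
  If \<open>q = 0\<close>, then moving from any dual point in the direction \<open>-p\<close> stays in the dual set, so the
  bound forces \<open>b \<bullet> p \<ge> 0\<close>.\<close>
lemma dual_bound_attained_by_primal:
  fixes A :: "real ^ 'n ^ 'm"
  assumes ne: "dual_set A \<mu> \<noteq> {}"
    and bound: "\<And>y. y \<in> dual_set A \<mu> \<Longrightarrow> b \<bullet> y \<le> r"
  obtains x where "x \<in> nonneg_orthant" "A *v x = b" "\<mu> \<bullet> x \<le> r"
proof -
  define S where "S = insert (0, 1) (range (\<lambda>j. (column j A, \<mu> $ j)))"
  define T where "T = {(A *v x, s) | x s. x \<in> nonneg_orthant \<and> \<mu> \<bullet> x \<le> s}"
  have "(b, r) \<in> convex_cone hull S"
  proof (rule farkas_convex_cone_hull)
    show "finite S" by (simp add: S_def)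
    fix a assume a: "\<And>s. s \<in> S \<Longrightarrow> 0 \<le> a \<bullet> s"
    obtain p q where pq: "a = (p, q)" by (cases a)
    have q: "0 \<le> q" using a[of "(0, 1)"] by (simp add: S_def pq)
    have col: "0 \<le> column j A \<bullet> p + q * \<mu> $ j" for j
      using a[of "(column j A, \<mu> $ j)"] by (simp add: S_def pq inner_commute)
    have "0 \<le> b \<bullet> p + q * r"
    proof (cases "q = 0")
      case False
      with q have q: "0 < q" by simp
      have "(- 1 / q) *\<^sub>R p \<in> dual_set A \<mu>"
        unfolding dual_set_iff
      proof
        fix j
        have "- (column j A \<bullet> p) \<le> \<mu> $ j * q" using col[of j] by (simp add: mult.commute)
        then show "column j A \<bullet> ((- 1 / q) *\<^sub>R p) \<le> \<mu> $ j"
          using q pos_divide_le_eq[OF q, of "- (column j A \<bullet> p)"] by simp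
      qed
      from bound[OF this] q show ?thesis by (simp add: field_simps)
    next
      case True
      obtain y0 where y0: "y0 \<in> dual_set A \<mu>" using ne by blast
      show ?thesis
      proof (rule ccontr)
        assume "\<not> ?thesis"
        with True have neg: "b \<bullet> p < 0" by simp
        have le: "b \<bullet> y0 - t * (b \<bullet> p) \<le> r" if "0 \<le> t" for t
        proof -
          have "column j A \<bullet> (y0 - t *\<^sub>R p) \<le> \<mu> $ j" for j
          proof -
            have "0 \<le> t * (column j A \<bullet> p)" using col[of j] True that by simp
            moreover have "column j A \<bullet> y0 \<le> \<mu> $ j" using y0 by (simp add: dual_set_iff)
            ultimately show ?thesis by (simp add: inner_diff_right)
          qed
          then have "y0 - t *\<^sub>R p \<in> dual_set A \<mu>" by (simp add: dual_set_iff)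
          from bound[OF this] show ?thesis by (simp add: inner_diff_right)
        qed
        \<comment> \<open>The \<open>t\<close> at which the dual value reaches \<open>r + 1\<close>.\<close>
        define t where "t = (b \<bullet> y0 - r - 1) / (b \<bullet> p)"
        have "0 \<le> t" using bound[OF y0] neg by (simp add: t_def divide_nonpos_neg)
        from le[OF this] neg show False by (simp add: t_def)
      qed
    qed
    then show "0 \<le> a \<bullet> (b, r)" by (simp add: pq inner_commute mult.commute)
  qed
  also have "\<dots> \<subseteq> T"
  proof (rule hull_minimal)
    have "(column j A, \<mu> $ j) \<in> T" for j
    proof -
      have "axis j 1 \<in> nonneg_orthant" by (simp add: nonneg_orthant_def axis_def)
      moreover have "A *v axis j 1 = column j A" "\<mu> \<bullet> axis j 1 \<le> \<mu> $ j"
        by (simp_all add: matrix_vector_mult_basis inner_axis_one)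
      ultimately show ?thesis unfolding T_def by (metis (mono_tags, lifting) mem_Collect_eq)
    qed
    moreover have "(0, 1) \<in> T"
      unfolding T_def by (auto simp: nonneg_orthant_def intro!: exI[of _ 0])
    ultimately show "S \<subseteq> T" by (auto simp: S_def)
    show "convex_cone T"
      unfolding convex_cone_iff
    proof (intro conjI ballI allI impI)
      show "0 \<in> T"
        unfolding T_def by (auto simp: zero_prod_def nonneg_orthant_def intro!: exI[of _ 0])
    next
      fix u v assume "u \<in> T" "v \<in> T"
      then obtain x s x' s' where "u = (A *v x, s)" "v = (A *v x', s')"
        and "x \<in> nonneg_orthant" "\<mu> \<bullet> x \<le> s" "x' \<in> nonneg_orthant" "\<mu> \<bullet> x' \<le> s'"
        unfolding T_def by blast
      then have "u + v = (A *v (x + x'), s + s')" "x + x' \<in> nonneg_orthant"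
        "\<mu> \<bullet> (x + x') \<le> s + s'"
        by (auto simp: matrix_vector_right_distrib nonneg_orthant_def inner_add_right)
      then show "u + v \<in> T" unfolding T_def by blast
    next
      fix u and c :: real assume "u \<in> T" "0 \<le> c"
      then obtain x s where "u = (A *v x, s)" "x \<in> nonneg_orthant" "\<mu> \<bullet> x \<le> s"
        unfolding T_def by blast
      then have "c *\<^sub>R u = (A *v (c *\<^sub>R x), c * s)" "c *\<^sub>R x \<in> nonneg_orthant"
        "\<mu> \<bullet> (c *\<^sub>R x) \<le> c * s"
        using \<open>0 \<le> c\<close>
        by (auto simp: matrix_vector_mult_scaleR nonneg_orthant_def mult_left_mono)
      then show "c *\<^sub>R u \<in> T" unfolding T_def by blast
    qed
  qed
  finally show thesis unfolding T_def using that by blast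
qed

lemma support_fn_dual_set:
  fixes A :: "real ^ 'n ^ 'm"
  assumes "dual_set A \<mu> \<noteq> {}"
  shows "support_fn (dual_set A \<mu>) b = opt_val A {b} \<mu>"
proof (rule antisym)
  show "support_fn (dual_set A \<mu>) b \<le> opt_val A {b} \<mu>"
    unfolding support_fn_def opt_val_def
    by (intro SUP_least INF_greatest) (auto simp: sol_set_def dual_set_weak_duality)
  show "opt_val A {b} \<mu> \<le> support_fn (dual_set A \<mu>) b"
    \<comment> \<open>Comparing real upper bounds treats finite and infinite values alike.\<close>
  proof (rule ereal_le_real)
    fix r assume "support_fn (dual_set A \<mu>) b \<le> ereal r"
    then have "b \<bullet> y \<le> r" if "y \<in> dual_set A \<mu>" for y
      using that by (auto simp: support_fn_def SUP_le_iff)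
    then obtain x where "x \<in> nonneg_orthant" "A *v x = b" "\<mu> \<bullet> x \<le> r"
      using dual_bound_attained_by_primal[OF assms] by metis
    then show "opt_val A {b} \<mu> \<le> ereal r"
      unfolding opt_val_def by (intro INF_lower2[of x]) (auto simp: sol_set_def)
  qed
qed

lemma opt_val_eq_INF: "opt_val A B \<mu> = (INF b\<in>B. opt_val A {b} \<mu>)"
proof (rule antisym)
  show "opt_val A B \<mu> \<le> (INF b\<in>B. opt_val A {b} \<mu>)"
    unfolding opt_val_def
    by (intro INF_greatest INF_superset_mono) (auto simp: sol_set_def)
  show "(INF b\<in>B. opt_val A {b} \<mu>) \<le> opt_val A B \<mu>"
    unfolding opt_val_def
  proof (rule INF_greatest)
    fix x assume x: "x \<in> sol_set A nonneg_orthant B"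
    then have "x \<in> sol_set A nonneg_orthant {A *v x}" "A *v x \<in> B"
      by (auto simp: sol_set_def)
    then show "(INF b\<in>B. INF x\<in>sol_set A nonneg_orthant {b}. ereal (\<mu> \<bullet> x)) \<le> ereal (\<mu> \<bullet> x)"
      by (meson INF_lower INF_lower2)
  qed
qed

theorem proposition4p3:
  fixes A :: "real ^ 'n ^ 'm"
    and B :: "(real ^ 'm) set"
    and \<mu> :: "real ^ 'n"
    and \<eta>0 :: real
  assumes "B \<noteq> {}"
    and "sol_set A nonneg_orthant B \<noteq> {}"
    and "sol_set A nonneg_orthant B \<noteq> nonneg_orthant"
    and "sublinear_ineq A B \<mu> \<eta>0"
  shows "(\<forall>i. perp_axis i \<inter> {\<mu> - w | w. w \<in> range (\<lambda>y. transpose A *v y)} \<noteq> {} \<and>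
              support_fn (dual_set A \<mu>) (column i A) = ereal (\<mu> $ i)) \<and>
         (INF b\<in>B. support_fn (dual_set A \<mu>) b) = opt_val A B \<mu>"
proof -
  have tight: "\<exists>y \<in> dual_set A \<mu>. column i A \<bullet> y = \<mu> $ i \<and> \<mu> - transpose A *v y \<in> perp_axis i" for i
  proof -
    obtain y where y: "\<mu> - transpose A *v y \<in> perp_axis i"
      using perp_axis_meets_translate[OF assms(4)] .
    then show ?thesis
      by (intro bexI[of _ y])
        (auto simp: perp_axis_def nonneg_orthant_def dual_set_iff transpose_mult_nth
          simp del: transpose_matrix_vector)
  qed
  then have ne: "dual_set A \<mu> \<noteq> {}" by blast
  have "perp_axis i \<inter> {\<mu> - w | w. w \<in> range (\<lambda>y. transpose A *v y)} \<noteq> {}" for i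
    using tight[of i] by blast
  moreover have "support_fn (dual_set A \<mu>) (column i A) = ereal (\<mu> $ i)" for i
  proof (rule antisym)
    show "support_fn (dual_set A \<mu>) (column i A) \<le> ereal (\<mu> $ i)"
      unfolding support_fn_def by (rule SUP_least) (simp add: dual_set_iff)
    show "ereal (\<mu> $ i) \<le> support_fn (dual_set A \<mu>) (column i A)"
      unfolding support_fn_def using tight[of i] by (auto intro: SUP_upper2)
  qed
  moreover have "(INF b\<in>B. support_fn (dual_set A \<mu>) b) = opt_val A B \<mu>"
    by (simp add: support_fn_dual_set[OF ne] opt_val_eq_INF[of A B])
  ultimately show ?thesis by blast
qed

end
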